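(* The signed total Roman domination numbers of the graphs $T_n$ satisfy: $\gamma_{stR}(T_{2k})=2k$ for every integer $k\geq 3$; and $2k+1\leq\gamma_{stR}(T_{2k+1})\leq 2k+2$ for every integer $k\geq 2$.
   Context: Graphs are finite, undirected and simple. For a vertex $v$ of a graph $G=(V,E)$, $N(v)=\{u\in V\mid uv\in E\}$. A signed total Roman domination (STRD) function on $G$ is a function $f:V\to\{-1,1,2\}$ such that (i) $\sum_{u\in N(v)}f(u)\geq 1$ for every $v\in V$, and (ii) every $v\in V$ with $f(v)=-1$ has a neighbor $u\in N(v)$ with $f(u)=2$. The weight of $f$ is $f(V)=\sum_{v\in V}f(v)$, and the signed total Roman domination number $\gamma_{stR}(G)$ is the minimum weight of an STRD function on $G$. The graph $T_n$ has $4n$ distinct vertices $V(T_n)=\{a_i,b_i,c_i,d_i\mid i=0,\ldots,n-1\}$ and edge set $E(T_n)=\{a_ia_{i+1},\,b_ib_{i+1},\,c_ic_{i+1},\,d_id_{i+1},\,a_ib_i,\,b_ic_i,\,c_id_i,\,a_{i+1}b_i,\,c_id_{i+1}\mid i=0,\ldots,n-1\}$, with vertex indices taken modulo $n$. *)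

theory Defs
  imports Main "HOL-Library.FuncSet" "Graph_Theory.Pair_Digraph"
begin

text \<open>
  A finite undirected simple graph is a \<^locale>\<open>pair_graph\<close>: an undirected edge $uv$
  is represented by the two arcs \<^term>\<open>(u, v)\<close> and \<^term>\<open>(v, u)\<close>.
\<close>

definition neighborhood :: "'a pair_pre_digraph \<Rightarrow> 'a \<Rightarrow> 'a set" where
  "neighborhood G v = {u \<in> pverts G. (u, v) \<in> parcs G}"

text \<open>
  Membership in the extensional function space makes \<^term>\<open>f\<close> a function on the vertex
  set only, so that there are finitely many such \<^term>\<open>f\<close> on a finite graph.
\<close>

definition is_STRD :: "'a pair_pre_digraph \<Rightarrow> ('a \<Rightarrow> int) \<Rightarrow> bool" where
  "is_STRD G f \<longleftrightarrow>
     f \<in> pverts G \<rightarrow>\<^sub>E {-1, 1, 2} \<and>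
     (\<forall>v \<in> pverts G. (\<Sum>u \<in> neighborhood G v. f u) \<ge> 1) \<and>
     (\<forall>v \<in> pverts G. f v = -1 \<longrightarrow> (\<exists>u \<in> neighborhood G v. f u = 2))"

definition weight :: "'a pair_pre_digraph \<Rightarrow> ('a \<Rightarrow> int) \<Rightarrow> int" where
  "weight G f = (\<Sum>v \<in> pverts G. f v)"

text \<open>
  On a finite graph without isolated vertices the constant function $1$ is an STRD
  function, so the minimum below is over a finite nonempty set
  (otherwise \<^term>\<open>Min {}\<close> is unspecified).
\<close>

definition gamma_stR :: "'a pair_pre_digraph \<Rightarrow> int" where
  "gamma_stR G = Min {weight G f | f. is_STRD G f}"

datatype T_vertex = VA nat | VB nat | VC nat | VD nat

definition T_edges :: "nat \<Rightarrow> (T_vertex \<times> T_vertex) set" where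
  "T_edges n = (\<Union>i \<in> {0..<n}.
     {(VA i, VA ((i + 1) mod n)), (VB i, VB ((i + 1) mod n)),
      (VC i, VC ((i + 1) mod n)), (VD i, VD ((i + 1) mod n)),
      (VA i, VB i), (VB i, VC i), (VC i, VD i),
      (VA ((i + 1) mod n), VB i), (VC i, VD ((i + 1) mod n))})"

definition T_graph :: "nat \<Rightarrow> T_vertex pair_pre_digraph" where
  "T_graph n =
     \<lparr>pverts = (\<Union>i \<in> {0..<n}. {VA i, VB i, VC i, VD i}),
      parcs = T_edges n \<union> (T_edges n)\<inverse>\<rparr>"

lemma mod_Suc_neq_self:
  fixes i n :: nat
  assumes "2 \<le> n" "i < n"
  shows "Suc i mod n \<noteq> i"
  using assms by (cases "Suc i = n") auto

lemma pair_graph_T_graph: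
  assumes "2 \<le> n"
  shows "pair_graph (T_graph n)"
proof
  show "finite (pverts (T_graph n))" "finite (parcs (T_graph n))"
    by (auto simp: T_graph_def T_edges_def)
  show "symmetric (with_proj (T_graph n))"
    by (auto simp: symmetric_def T_graph_def arcs_ends_conv sym_def)
next
  fix e assume e: "e \<in> parcs (T_graph n)"
  show "fst e \<in> pverts (T_graph n)" "snd e \<in> pverts (T_graph n)"
    using e assms by (auto simp: T_graph_def T_edges_def)
  show "fst e \<noteq> snd e"
    using e mod_Suc_neq_self[OF assms] by (auto simp: T_graph_def T_edges_def) metis+
qed

end

theory Submission
  imports Defs
begin

text \<open>
  The open neighborhoods of the \<open>a\<^sub>i\<close> cover every \<open>a\<^sub>j\<close> and every \<open>b\<^sub>j\<close> exactly twice, so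
  adding up condition (i) over all \<open>a\<^sub>i\<close> shows that the \<open>a\<^sub>j\<close> and \<open>b\<^sub>j\<close> together weigh at
  least \<open>n / 2\<close>; the same holds for the \<open>d\<^sub>j\<close> and \<open>c\<^sub>j\<close>, whence the weight is at least \<open>n\<close>.
  Conversely, giving \<open>a\<^sub>i\<close> and \<open>d\<^sub>i\<close> the value \<open>-1\<close>, and \<open>b\<^sub>i\<close> and \<open>c\<^sub>i\<close> the value \<open>2\<close> for
  even \<open>i\<close> and \<open>1\<close> for odd \<open>i\<close>, is an STRD function: for odd \<open>n\<close> the two values \<open>2\<close> that
  become adjacent around the end of the cycle do no harm.
\<close>

text \<open>Subtraction on \<open>nat\<close> truncates, so \<open>(i - 1) mod n\<close> would fail
  to wrap around at \<open>i = 0\<close>.\<close>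

definition cycle_pred :: "nat \<Rightarrow> nat \<Rightarrow> nat" where
  "cycle_pred n i = (if i = 0 then n - 1 else i - 1)"

lemma cycle_pred_less: "i < n \<Longrightarrow> cycle_pred n i < n"
  by (auto simp: cycle_pred_def)

lemma Suc_mod_eq_iff_cycle_pred:
  assumes "i < n" "j < n"
  shows "Suc j mod n = i \<longleftrightarrow> j = cycle_pred n i"
  using assms by (cases "Suc j = n") (auto simp: cycle_pred_def)

lemma cycle_pred_Suc_mod: "i < n \<Longrightarrow> cycle_pred n (Suc i mod n) = i"
  using Suc_mod_eq_iff_cycle_pred[of "Suc i mod n" n i] by simp

lemma Suc_cycle_pred_mod: "i < n \<Longrightarrow> Suc (cycle_pred n i) mod n = i"
  using Suc_mod_eq_iff_cycle_pred[of i n "cycle_pred n i"] by (simp add: cycle_pred_less)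

text \<open>On a cycle of length 2 both sides coincide. From length 3 on, the neighbors of a vertex
  within its own cycle are distinct, so sums over neighborhoods split into single terms.\<close>

lemma cycle_pred_neq_Suc_mod:
  assumes "3 \<le> n" "i < n"
  shows "cycle_pred n i \<noteq> Suc i mod n"
  using assms by (cases "Suc i = n") (auto simp: cycle_pred_def)

lemma sum_Suc_mod: "(\<Sum>i<n. h (Suc i mod n)) = (\<Sum>i<n. h i)"
  by (rule sum.reindex_bij_witness[of _ "cycle_pred n" "\<lambda>i. Suc i mod n"])
    (auto simp: cycle_pred_Suc_mod Suc_cycle_pred_mod cycle_pred_less)

lemma sum_cycle_pred: "(\<Sum>i<n. h (cycle_pred n i)) = (\<Sum>i<n. h i)"
  by (rule sum.reindex_bij_witness[of _ "\<lambda>i. Suc i mod n" "cycle_pred n"])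
    (auto simp: cycle_pred_Suc_mod Suc_cycle_pred_mod cycle_pred_less)

lemma pverts_T_graph:
  "pverts (T_graph n) = VA ` {..<n} \<union> VB ` {..<n} \<union> VC ` {..<n} \<union> VD ` {..<n}"
  by (auto simp: T_graph_def)

lemma weight_T_graph:
  "weight (T_graph n) f = (\<Sum>i<n. f (VA i) + f (VB i) + f (VC i) + f (VD i))"
proof -
  have "inj_on VA A" "inj_on VB A" "inj_on VC A" "inj_on VD A" for A
    by (auto simp: inj_on_def)
  moreover have "VA ` A \<inter> VB ` A = {}" "(VA ` A \<union> VB ` A) \<inter> VC ` A = {}"
    "(VA ` A \<union> VB ` A \<union> VC ` A) \<inter> VD ` A = {}" for A
    by auto
  ultimately show ?thesis
    by (simp add: weight_def pverts_T_graph sum.union_disjoint sum.reindex sum.distrib)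
qed

lemma neighborhood_T_graph:
  assumes "i < n"
  shows "neighborhood (T_graph n) (VA i) =
      {VA (cycle_pred n i), VA (Suc i mod n), VB (cycle_pred n i), VB i}"
    and "neighborhood (T_graph n) (VB i) =
      {VB (cycle_pred n i), VB (Suc i mod n), VA i, VA (Suc i mod n), VC i}"
    and "neighborhood (T_graph n) (VC i) =
      {VC (cycle_pred n i), VC (Suc i mod n), VB i, VD i, VD (Suc i mod n)}"
    and "neighborhood (T_graph n) (VD i) =
      {VD (cycle_pred n i), VD (Suc i mod n), VC (cycle_pred n i), VC i}"
  using assms Suc_mod_eq_iff_cycle_pred[OF assms]
  by (auto simp: neighborhood_def T_graph_def T_edges_def cycle_pred_less Suc_cycle_pred_mod
      cycle_pred_Suc_mod)
    (metis Suc_cycle_pred_mod assms atLeast0LessThan cycle_pred_less lessThan_iff)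

lemma sum_neighborhood_T_graph:
  fixes f :: "T_vertex \<Rightarrow> int"
  assumes "3 \<le> n" "i < n"
  shows "sum f (neighborhood (T_graph n) (VA i)) =
      f (VA (cycle_pred n i)) + f (VA (Suc i mod n)) + f (VB (cycle_pred n i)) + f (VB i)"
    and "sum f (neighborhood (T_graph n) (VB i)) =
      f (VB (cycle_pred n i)) + f (VB (Suc i mod n)) + f (VA i) + f (VA (Suc i mod n)) + f (VC i)"
    and "sum f (neighborhood (T_graph n) (VC i)) =
      f (VC (cycle_pred n i)) + f (VC (Suc i mod n)) + f (VB i) + f (VD i) + f (VD (Suc i mod n))"
    and "sum f (neighborhood (T_graph n) (VD i)) =
      f (VD (cycle_pred n i)) + f (VD (Suc i mod n)) + f (VC (cycle_pred n i)) + f (VC i)"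
proof -
  have "cycle_pred n i \<noteq> Suc i mod n" "Suc i mod n \<noteq> i" "cycle_pred n i \<noteq> i"
    using assms cycle_pred_neq_Suc_mod mod_Suc_neq_self[of n i]
    by (auto simp: cycle_pred_def)
  then show "sum f (neighborhood (T_graph n) (VA i)) =
      f (VA (cycle_pred n i)) + f (VA (Suc i mod n)) + f (VB (cycle_pred n i)) + f (VB i)"
    and "sum f (neighborhood (T_graph n) (VB i)) =
      f (VB (cycle_pred n i)) + f (VB (Suc i mod n)) + f (VA i) + f (VA (Suc i mod n)) + f (VC i)"
    and "sum f (neighborhood (T_graph n) (VC i)) =
      f (VC (cycle_pred n i)) + f (VC (Suc i mod n)) + f (VB i) + f (VD i) + f (VD (Suc i mod n))"
    and "sum f (neighborhood (T_graph n) (VD i)) =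
      f (VD (cycle_pred n i)) + f (VD (Suc i mod n)) + f (VC (cycle_pred n i)) + f (VC i)"
    using not_sym[of "Suc i mod n" i] by (simp_all add: neighborhood_T_graph[OF assms(2)])
qed

lemma weight_T_graph_ge:
  assumes "3 \<le> n" "is_STRD (T_graph n) f"
  shows "int n \<le> weight (T_graph n) f"
proof -
  have nb: "1 \<le> sum f (neighborhood (T_graph n) v)" if "v \<in> pverts (T_graph n)" for v
    using assms(2) that by (simp add: is_STRD_def)
  have "int n = (\<Sum>i<n. 1)" by simp
  also have "\<dots> \<le> (\<Sum>i<n. sum f (neighborhood (T_graph n) (VA i)))"
    by (intro sum_mono nb) (auto simp: pverts_T_graph)
  \<comment> \<open>Double counting: \<open>VA j\<close> is seen from the two adjacent
    \<open>VA\<close>, and \<open>VB j\<close> from \<open>VA j\<close> and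
    \<open>VA (Suc j mod n)\<close>; the cyclic shifts reindex these sums.\<close>
  also have "\<dots> = 2 * (\<Sum>i<n. f (VA i)) + 2 * (\<Sum>i<n. f (VB i))"
    using assms(1) sum_Suc_mod[of "\<lambda>i. f (VA i)"] sum_cycle_pred[of "\<lambda>i. f (VA i)"]
      sum_cycle_pred[of "\<lambda>i. f (VB i)"]
    by (simp add: sum_neighborhood_T_graph sum.distrib)
  finally have AB: "int n \<le> 2 * (\<Sum>i<n. f (VA i)) + 2 * (\<Sum>i<n. f (VB i))" .
  have "int n = (\<Sum>i<n. 1)" by simp
  also have "\<dots> \<le> (\<Sum>i<n. sum f (neighborhood (T_graph n) (VD i)))"
    by (intro sum_mono nb) (auto simp: pverts_T_graph)
  also have "\<dots> = 2 * (\<Sum>i<n. f (VD i)) + 2 * (\<Sum>i<n. f (VC i))"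
    using assms(1) sum_Suc_mod[of "\<lambda>i. f (VD i)"] sum_cycle_pred[of "\<lambda>i. f (VD i)"]
      sum_cycle_pred[of "\<lambda>i. f (VC i)"]
    by (simp add: sum_neighborhood_T_graph sum.distrib)
  finally show ?thesis
    using AB by (simp add: weight_T_graph sum.distrib)
qed

definition alternating_value :: "nat \<Rightarrow> int" where
  "alternating_value i = (if even i then 2 else 1)"

fun alternating_labelling :: "T_vertex \<Rightarrow> int" where
  "alternating_labelling (VA i) = -1"
| "alternating_labelling (VB i) = alternating_value i"
| "alternating_labelling (VC i) = alternating_value i"
| "alternating_labelling (VD i) = -1"

lemma alternating_value_ge: "1 \<le> alternating_value i"
  by (simp add: alternating_value_def)

text \<open>Consecutive indices differ in parity; at the wrap-around, index 0 itself has value 2,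
  whatever the parity of \<open>n\<close>.\<close>

lemma alternating_value_pred:
  "alternating_value (cycle_pred n i) = 2 \<or> alternating_value i = 2"
  by (auto simp: alternating_value_def cycle_pred_def)

lemma is_STRD_alternating_labelling:
  assumes "3 \<le> n"
  shows "is_STRD (T_graph n) (restrict alternating_labelling (pverts (T_graph n)))"
    (is "is_STRD _ ?f")
proof -
  \<comment> \<open>\<open>restrict\<close> supplies the required extensionality; inside
    neighborhoods it can be ignored.\<close>
  have nbs: "neighborhood (T_graph n) v \<subseteq> pverts (T_graph n)" for v
    by (auto simp: neighborhood_def)
  have sum_eq: "(\<Sum>u \<in> neighborhood (T_graph n) v. ?f u) =
      (\<Sum>u \<in> neighborhood (T_graph n) v. alternating_labelling u)" for v
    using nbs by (intro sum.cong) auto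
  have "?f \<in> pverts (T_graph n) \<rightarrow>\<^sub>E {-1, 1, 2}"
    by (auto simp: pverts_T_graph alternating_value_def split: if_splits)
  moreover have "1 \<le> (\<Sum>u \<in> neighborhood (T_graph n) v. ?f u)"
    if v: "v \<in> pverts (T_graph n)" for v
  proof -
    obtain i where "i < n" "v \<in> {VA i, VB i, VC i, VD i}"
      using v by (auto simp: pverts_T_graph)
    then show ?thesis
      unfolding sum_eq
      \<comment> \<open>At \<open>VA i\<close> and \<open>VD i\<close> the sum is at least -2 + (1 +
        2), one of two consecutive values being 2; at \<open>VB i\<close> and \<open>VC i\<close> it
        is at least 3 - 2.\<close>
      using sum_neighborhood_T_graph[OF assms, of i alternating_labelling]
        alternating_value_pred[of n i] alternating_value_ge[of i]
        alternating_value_ge[of "cycle_pred n i"] alternating_value_ge[of "Suc i mod n"]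
      by auto
  qed
  moreover have "\<exists>u \<in> neighborhood (T_graph n) v. ?f u = 2"
    if v: "v \<in> pverts (T_graph n)" "?f v = -1" for v
  proof -
    have "\<exists>u \<in> neighborhood (T_graph n) v. alternating_labelling u = 2"
    proof -
      obtain i where "i < n" "v \<in> {VA i, VD i}"
        using v by (auto simp: pverts_T_graph alternating_value_def split: if_splits)
      then show ?thesis
        using neighborhood_T_graph[of i n] alternating_value_pred[of n i] by auto
    qed
    then show ?thesis using nbs by fastforce
  qed
  ultimately show ?thesis
    by (simp add: is_STRD_def)
qed

text \<open>Index \<open>i\<close> contributes 2 if it is even and 0 if it is odd, and
  \<open>(n + 1) div 2\<close> of the indices below \<open>n\<close> are even.\<close>

lemma weight_alternating_labelling:
  "weight (T_graph n) (restrict alternating_labelling (pverts (T_graph n))) =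
    2 * int ((n + 1) div 2)"
proof -
  have "weight (T_graph n) (restrict alternating_labelling (pverts (T_graph n))) =
      (\<Sum>i<n. 2 * alternating_value i - 2)"
    unfolding weight_T_graph by (intro sum.cong) (auto simp: pverts_T_graph)
  also have "\<dots> = 2 * int ((n + 1) div 2)"
    by (induction n) (auto simp: alternating_value_def elim!: evenE oddE)
  finally show ?thesis .
qed

lemma finite_STRD_weights:
  assumes "finite (pverts G)"
  shows "finite {weight G f | f. is_STRD G f}"
proof -
  have "{f. is_STRD G f} \<subseteq> pverts G \<rightarrow>\<^sub>E {-1, 1, 2}"
    by (auto simp: is_STRD_def)
  then have "finite {f. is_STRD G f}"
    using assms by (auto intro: finite_subset finite_PiE)
  then show ?thesis by simp
qed

lemma gamma_stR_le:
  assumes "finite (pverts G)" "is_STRD G f"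
  shows "gamma_stR G \<le> weight G f"
  unfolding gamma_stR_def using assms by (intro Min_le finite_STRD_weights) auto

lemma gamma_stR_T_graph_bounds:
  assumes "3 \<le> n"
  shows "int n \<le> gamma_stR (T_graph n)"
    and "gamma_stR (T_graph n) \<le> 2 * int ((n + 1) div 2)"
proof -
  have fin: "finite (pverts (T_graph n))"
    by (simp add: pverts_T_graph)
  show "gamma_stR (T_graph n) \<le> 2 * int ((n + 1) div 2)"
    using gamma_stR_le[OF fin is_STRD_alternating_labelling[OF assms]]
    by (simp only: weight_alternating_labelling)
  show "int n \<le> gamma_stR (T_graph n)"
    unfolding gamma_stR_def
    \<comment> \<open>The alternating labelling shows here that the set under \<open>Min\<close> is
      nonempty.\<close>
    using finite_STRD_weights[OF fin] is_STRD_alternating_labelling[OF assms]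
      weight_T_graph_ge[OF assms]
    by (subst Min_ge_iff) auto
qed

theorem theorem4:
  shows "(\<forall>k::nat. k \<ge> 3 \<longrightarrow> gamma_stR (T_graph (2 * k)) = 2 * int k) \<and>
    (\<forall>k::nat. k \<ge> 2 \<longrightarrow>
       2 * int k + 1 \<le> gamma_stR (T_graph (2 * k + 1)) \<and>
       gamma_stR (T_graph (2 * k + 1)) \<le> 2 * int k + 2)"
proof (intro conjI allI impI)
  fix k :: nat assume "3 \<le> k"
  \<comment> \<open>For even \<open>n\<close> the rounding in \<open>(n + 1) div 2\<close> makes the
    two bounds meet; for odd \<open>n\<close> they differ by one.\<close>
  then show "gamma_stR (T_graph (2 * k)) = 2 * int k"
    using gamma_stR_T_graph_bounds[of "2 * k"] by simp
next
  fix k :: nat assume "2 \<le> k"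
  then show "2 * int k + 1 \<le> gamma_stR (T_graph (2 * k + 1))"
    and "gamma_stR (T_graph (2 * k + 1)) \<le> 2 * int k + 2"
    using gamma_stR_T_graph_bounds[of "2 * k + 1"] by simp_all
qed

end
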